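(* For every positive integer $n\notin\{2,3,5\}$, the complete graph $K_n$ admits a $\mu$-simultaneous edge coloring for $\mu=2$ and for $\mu=3$.
   Context: $[l]=\{1,\ldots,l\}$. A $\mu$-simultaneous edge coloring of a graph $G$ is a $\mu$-tuple $(c_1,\ldots,c_\mu)$ of proper edge colorings $c_i:E(G)\to[l]$ (with a common color set $[l]$) such that (1) for every vertex $v$, the set $\{c_i(e): e \text{ incident to } v\}$ is the same for all $i$, and (2) $c_i(e)\neq c_j(e)$ for every edge $e$ and all $i\neq j$. *)

theory Defs
  imports Main "HOL-Library.FuncSet" "HOL-Library.Ramsey"
begin

text \<open>
  A simple graph is given by its vertex set \<open>V\<close> and its edge set
  \<open>E \<subseteq> nsets V 2\<close>, an edge being the two-element set of its endpoints.
  The complete graph \<open>K\<^sub>n\<close> has vertex set \<open>{1..n}\<close>.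
\<close>

definition K_verts :: "nat \<Rightarrow> nat set" where
  "K_verts n = {1..n}"

definition K_edges :: "nat \<Rightarrow> nat set set" where
  "K_edges n = nsets (K_verts n) 2"

definition proper_edge_coloring :: "'a set set \<Rightarrow> nat \<Rightarrow> ('a set \<Rightarrow> nat) \<Rightarrow> bool" where
  "proper_edge_coloring E l c \<longleftrightarrow>
     c \<in> E \<rightarrow> {1..l} \<and>
     (\<forall>e\<in>E. \<forall>f\<in>E. e \<noteq> f \<and> e \<inter> f \<noteq> {} \<longrightarrow> c e \<noteq> c f)"

definition incident_edges :: "'a set set \<Rightarrow> 'a \<Rightarrow> 'a set set" where
  "incident_edges E v = {e \<in> E. v \<in> e}"

text \<open>The tuple \<open>(c\<^sub>1, \<dots>, c\<^sub>\<mu>)\<close> is a function of the index; only its values on \<open>{1..\<mu>}\<close> matter.\<close>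

definition simultaneous_edge_coloring ::
  "nat \<Rightarrow> 'a set \<Rightarrow> 'a set set \<Rightarrow> nat \<Rightarrow> (nat \<Rightarrow> 'a set \<Rightarrow> nat) \<Rightarrow> bool" where
  "simultaneous_edge_coloring \<mu> V E l c \<longleftrightarrow>
     (\<forall>i\<in>{1..\<mu>}. proper_edge_coloring E l (c i)) \<and>
     (\<forall>v\<in>V. \<forall>i\<in>{1..\<mu>}. \<forall>j\<in>{1..\<mu>}. c i ` incident_edges E v = c j ` incident_edges E v) \<and>
     (\<forall>e\<in>E. \<forall>i\<in>{1..\<mu>}. \<forall>j\<in>{1..\<mu>}. i \<noteq> j \<longrightarrow> c i e \<noteq> c j e)"

definition admits_simultaneous_edge_coloring :: "nat \<Rightarrow> 'a set \<Rightarrow> 'a set set \<Rightarrow> bool" where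
  "admits_simultaneous_edge_coloring \<mu> V E \<longleftrightarrow>
     (\<exists>l c. simultaneous_edge_coloring \<mu> V E l c)"

end

theory Submission
  imports Defs "HOL-Number_Theory.Cong"
begin

text \<open>
  Any \<open>l\<close>-regular graph with a proper \<open>l\<close>-edge coloring, \<open>\<mu> \<le> l\<close>, has a \<open>\<mu>\<close>-simultaneous coloring:
  every vertex sees all colors, so cyclic shifts of the colors do not change what a vertex sees.
  This settles \<open>K\<^sub>n\<close> for even \<open>n \<ge> 4\<close>. Complete bipartite graphs with both sides of size at least
  \<open>\<mu>\<close> are handled by cyclically shifting the rows of a cyclic Latin rectangle. Since the number
  of colors is unrestricted, an edge-disjoint union is colored by using disjoint sets of colors.
  For odd \<open>n \<ge> 7\<close>, \<open>K\<^sub>n\<close> is the union of a \<open>K\<^sub>4\<close> and a \<open>K\<^bsub>n-3\<^esub>\<close> sharing a vertex, and of the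
  \<open>K\<^bsub>3,n-4\<^esub>\<close> between their remaining vertices.
\<close>

section \<open>Cancellation and rotation modulo m\<close>

text \<open>Cancelling \<open>i\<close> leaves a congruence modulo \<open>m\<close>, and congruent
  numbers less than \<open>m\<close> apart are equal. Bounding the distance of \<open>x\<close> and
  \<open>y\<close>, not their size, covers \<open>{1..l}\<close> as well as
  \<open>{..<m}\<close>.\<close>

lemma mod_add_right_inj:
  fixes x y i m :: nat
  assumes "(x + i) mod m = (y + i) mod m" "x < y + m" "y < x + m"
  shows "x = y"
proof -
  have "u = v" if "[u = v] (mod m)" "v < u + m" "u \<le> v" for u v :: nat
  proof -
    have "m dvd v - u"
      using that by (simp add: cong_altdef_nat cong_sym_eq[of u])
    then show ?thesis
      using that nat_dvd_not_less[of "v - u" m] by linarith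
  qed
  moreover have "[x = y] (mod m)"
    using assms(1) by (metis cong_add_rcancel_nat cong_def)
  ultimately show ?thesis
    using assms(2,3) by (metis cong_sym nat_le_linear)
qed

text \<open>The shifted map stays injective by cancellation and takes values in a set of the same
  size \<open>m\<close>, so it is onto.\<close>

lemma bij_betw_mod_add:
  fixes h :: "'a \<Rightarrow> nat"
  assumes "bij_betw h A {..<m}"
  shows "bij_betw (\<lambda>x. (h x + i) mod m) A {..<m}"
proof (rule bij_betw_imageI)
  have lt: "h x < m" if "x \<in> A" for x
    using assms that by (auto simp: bij_betw_def)
  have inj: "inj_on h A"
    using assms by (simp add: bij_betw_def)
  show inj': "inj_on (\<lambda>x. (h x + i) mod m) A"
    using lt by (auto intro!: inj_onI inj_onD[OF inj] dest!: mod_add_right_inj intro: trans_less_add2)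
  have "card A = m"
    using bij_betw_same_card[OF assms] by simp
  moreover have "(\<lambda>x. (h x + i) mod m) ` A \<subseteq> {..<m}"
    using lt by (fastforce intro!: mod_less_divisor)
  ultimately show "(\<lambda>x. (h x + i) mod m) ` A = {..<m}"
    by (simp add: card_subset_eq card_image inj')
qed

section \<open>Rules for simultaneous colorings and edge-disjoint unions\<close>

text \<open>The color set at \<open>v\<close> is given by a value \<open>S v\<close> that does not
  depend on \<open>i\<close>, so one computation per index replaces the comparison of pairs of
  indices.\<close>

lemma simultaneous_edge_coloringI:
  assumes "\<And>i e. i \<in> {1..\<mu>} \<Longrightarrow> e \<in> E \<Longrightarrow> c i e \<in> {1..l}"
    and "\<And>i e f. i \<in> {1..\<mu>} \<Longrightarrow> e \<in> E \<Longrightarrow> f \<in> E \<Longrightarrow> e \<inter> f \<noteq> {} \<Longrightarrow> c i e = c i f \<Longrightarrow> e = f"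
    and "\<And>i v. i \<in> {1..\<mu>} \<Longrightarrow> v \<in> V \<Longrightarrow> c i ` incident_edges E v = S v"
    and "\<And>i j e. i \<in> {1..\<mu>} \<Longrightarrow> j \<in> {1..\<mu>} \<Longrightarrow> e \<in> E \<Longrightarrow> c i e = c j e \<Longrightarrow> i = j"
  shows "simultaneous_edge_coloring \<mu> V E l c"
proof -
  have "proper_edge_coloring E l (c i)" if "i \<in> {1..\<mu>}" for i
    unfolding proper_edge_coloring_def using assms(1,2)[OF that] by blast
  moreover have "c i ` incident_edges E v = c j ` incident_edges E v"
    if "i \<in> {1..\<mu>}" "j \<in> {1..\<mu>}" "v \<in> V" for i j v
    using assms(3)[OF that(1,3)] assms(3)[OF that(2,3)] by simp
  ultimately show ?thesis
    unfolding simultaneous_edge_coloring_def using assms(4) by blast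
qed

lemma simultaneous_edge_coloringD:
  assumes "simultaneous_edge_coloring \<mu> V E l c" "i \<in> {1..\<mu>}"
  shows "e \<in> E \<Longrightarrow> c i e \<in> {1..l}"
    and "e \<in> E \<Longrightarrow> f \<in> E \<Longrightarrow> e \<inter> f \<noteq> {} \<Longrightarrow> c i e = c i f \<Longrightarrow> e = f"
    and "v \<in> V \<Longrightarrow> c i ` incident_edges E v = c 1 ` incident_edges E v"
    and "j \<in> {1..\<mu>} \<Longrightarrow> e \<in> E \<Longrightarrow> c i e = c j e \<Longrightarrow> i = j"
proof -
  have proper: "proper_edge_coloring E l (c i)"
    and same: "\<forall>v\<in>V. \<forall>i\<in>{1..\<mu>}. \<forall>j\<in>{1..\<mu>}. c i ` incident_edges E v = c j ` incident_edges E v"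
    and disj: "\<forall>e\<in>E. \<forall>i\<in>{1..\<mu>}. \<forall>j\<in>{1..\<mu>}. i \<noteq> j \<longrightarrow> c i e \<noteq> c j e"
    using assms unfolding simultaneous_edge_coloring_def by blast+
  show "e \<in> E \<Longrightarrow> c i e \<in> {1..l}"
    and "e \<in> E \<Longrightarrow> f \<in> E \<Longrightarrow> e \<inter> f \<noteq> {} \<Longrightarrow> c i e = c i f \<Longrightarrow> e = f"
    using proper unfolding proper_edge_coloring_def by (blast dest: funcset_mem)+
  have "1 \<in> {1..\<mu>}"
    using assms(2) by simp
  then show "v \<in> V \<Longrightarrow> c i ` incident_edges E v = c 1 ` incident_edges E v"
    using same assms(2) by metis
  show "j \<in> {1..\<mu>} \<Longrightarrow> e \<in> E \<Longrightarrow> c i e = c j e \<Longrightarrow> i = j"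
    using disj assms(2) by metis
qed

lemma admits_simultaneous_edge_coloring_mono:
  assumes "admits_simultaneous_edge_coloring \<mu> V E" "\<mu>' \<le> \<mu>" "V' \<subseteq> V"
  shows "admits_simultaneous_edge_coloring \<mu>' V' E"
proof -
  obtain l c where c: "simultaneous_edge_coloring \<mu> V E l c"
    using assms by (auto simp: admits_simultaneous_edge_coloring_def)
  have sub: "i \<in> {1..\<mu>}" if "i \<in> {1..\<mu>'}" for i
    using that assms by auto
  have "simultaneous_edge_coloring \<mu>' V' E l c"
  proof (rule simultaneous_edge_coloringI)
    fix i v assume "i \<in> {1..\<mu>'}" "v \<in> V'"
    then show "c i ` incident_edges E v = c 1 ` incident_edges E v"
      using \<open>V' \<subseteq> V\<close> by (intro simultaneous_edge_coloringD(3)[OF c sub]) auto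
  next
    fix i j e assume "i \<in> {1..\<mu>'}" "j \<in> {1..\<mu>'}" "e \<in> E" "c i e = c j e"
    then show "i = j"
      using simultaneous_edge_coloringD(4)[OF c sub sub] by blast
  qed (use simultaneous_edge_coloringD(1,2)[OF c sub] in blast)+
  then show ?thesis
    by (auto simp: admits_simultaneous_edge_coloring_def)
qed

lemma admits_simultaneous_edge_coloring_Un:
  assumes "admits_simultaneous_edge_coloring \<mu> V E" "admits_simultaneous_edge_coloring \<mu> V F"
    and "E \<inter> F = {}"
  shows "admits_simultaneous_edge_coloring \<mu> V (E \<union> F)"
proof -
  obtain l c where c: "simultaneous_edge_coloring \<mu> V E l c"
    using assms by (auto simp: admits_simultaneous_edge_coloring_def)
  obtain k d where d: "simultaneous_edge_coloring \<mu> V F k d"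
    using assms by (auto simp: admits_simultaneous_edge_coloring_def)
  \<comment> \<open>Colors of \<open>F\<close> are moved above \<open>l\<close>, so that no edge of
    \<open>E\<close> shares a color with an edge of \<open>F\<close>.\<close>
  define h where "h i e = (if e \<in> E then c i e else l + d i e)" for i e
  have hE: "h i e = c i e" "h i e \<in> {1..l}" if "i \<in> {1..\<mu>}" "e \<in> E" for i e
    using that simultaneous_edge_coloringD(1)[OF c that] by (auto simp: h_def)
  have hF: "h i e = l + d i e" "h i e \<in> {l+1..l+k}" if "i \<in> {1..\<mu>}" "e \<in> F" for i e
  proof -
    have "e \<notin> E"
      using that assms(3) by auto
    then show "h i e = l + d i e"
      by (simp add: h_def)
    moreover have "d i e \<in> {1..k}"
      using simultaneous_edge_coloringD(1)[OF d that] .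
    ultimately show "h i e \<in> {l+1..l+k}"
      by auto
  qed
  have "simultaneous_edge_coloring \<mu> V (E \<union> F) (l + k) h"
  proof (rule simultaneous_edge_coloringI)
    fix i e assume "i \<in> {1..\<mu>}" "e \<in> E \<union> F"
    then show "h i e \<in> {1..l+k}"
      using hE(2)[of i e] hF(2)[of i e] by auto
  next
    fix i e f assume i: "i \<in> {1..\<mu>}" and ef: "e \<in> E \<union> F" "f \<in> E \<union> F" "e \<inter> f \<noteq> {}"
      and eq: "h i e = h i f"
    \<comment> \<open>The color of an edge reveals which of the two edge sets it belongs to; this
      rules out mixed pairs.\<close>
    have low: "h i g \<le> l \<longleftrightarrow> g \<in> E" if "g \<in> E \<union> F" for g
      using that hE(2)[OF i, of g] hF(2)[OF i, of g] by fastforce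
    consider "e \<in> E" "f \<in> E" | "e \<in> F" "f \<in> F"
      using low[OF ef(1)] low[OF ef(2)] ef(1,2) eq by auto
    then show "e = f"
    proof cases
      case 1
      then show ?thesis
        using simultaneous_edge_coloringD(2)[OF c i] ef eq by (simp add: hE(1)[OF i])
    next
      case 2
      then show ?thesis
        using simultaneous_edge_coloringD(2)[OF d i] ef eq by (simp add: hF(1)[OF i])
    qed
  next
    fix i v assume i: "i \<in> {1..\<mu>}" and v: "v \<in> V"
    have "incident_edges (E \<union> F) v = incident_edges E v \<union> incident_edges F v"
      by (auto simp: incident_edges_def)
    moreover have "h i ` incident_edges E v = c i ` incident_edges E v"
      using hE(1)[OF i] by (intro image_cong) (auto simp: incident_edges_def)
    moreover have "h i ` incident_edges F v = (+) l ` d i ` incident_edges F v"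
      using hF(1)[OF i] unfolding image_image by (intro image_cong) (auto simp: incident_edges_def)
    moreover have "c i ` incident_edges E v = c 1 ` incident_edges E v"
      using simultaneous_edge_coloringD(3)[OF c i v] .
    moreover have "d i ` incident_edges F v = d 1 ` incident_edges F v"
      using simultaneous_edge_coloringD(3)[OF d i v] .
    ultimately show "h i ` incident_edges (E \<union> F) v =
        c 1 ` incident_edges E v \<union> (+) l ` d 1 ` incident_edges F v"
      by (simp only: image_Un)
  next
    fix i j e assume i: "i \<in> {1..\<mu>}" "j \<in> {1..\<mu>}" and "e \<in> E \<union> F" "h i e = h j e"
    moreover have "i = j" if "e \<in> E" "c i e = c j e"
      using simultaneous_edge_coloringD(4)[OF c i] that by blast
    moreover have "i = j" if "e \<in> F" "d i e = d j e"
      using simultaneous_edge_coloringD(4)[OF d i] that by blast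
    ultimately show "i = j"
      using hE(1)[of i e] hE(1)[of j e] hF(1)[of i e] hF(1)[of j e] by auto
  qed
  then show ?thesis
    by (auto simp: admits_simultaneous_edge_coloring_def)
qed

section \<open>Regular graphs\<close>

lemma admits_simultaneous_edge_coloring_regular:
  assumes c: "proper_edge_coloring E l c"
    and deg: "\<And>v. v \<in> V \<Longrightarrow> incident_edges E v = {} \<or> card (incident_edges E v) = l"
    and "\<mu> \<le> l"
  shows "admits_simultaneous_edge_coloring \<mu> V E"
proof -
  define h where "h i e = Suc ((c e + i) mod l)" for i e
  have c_range: "c e \<in> {1..l}" if "e \<in> E" for e
    using c that by (auto simp: proper_edge_coloring_def)
  have h_range: "h i e \<in> {1..l}" if "e \<in> E" for i e
    using c_range[OF that] by (simp add: h_def Suc_le_eq)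
  have h_inj: "e = f" if "e \<in> E" "f \<in> E" "e \<inter> f \<noteq> {}" "h i e = h i f" for i e f
  proof -
    have "c e = c f"
      using that c_range[of e] c_range[of f] by - (rule mod_add_right_inj[of _ i l], auto simp: h_def)
    then show ?thesis
      using c that unfolding proper_edge_coloring_def by blast
  qed
  have "simultaneous_edge_coloring \<mu> V E l h"
  proof (rule simultaneous_edge_coloringI)
    fix i v assume v: "v \<in> V"
    have "h i ` incident_edges E v = {1..l}" if "card (incident_edges E v) = l"
    proof (rule card_subset_eq)
      show "h i ` incident_edges E v \<subseteq> {1..l}"
        using h_range unfolding incident_edges_def by blast
      have "inj_on (h i) (incident_edges E v)"
        using h_inj unfolding inj_on_def incident_edges_def by blast
      then show "card (h i ` incident_edges E v) = card {1..l}"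
        using that by (simp add: card_image)
    qed simp
    then show "h i ` incident_edges E v = (if incident_edges E v = {} then {} else {1..l})"
      using deg[OF v] by auto
  next
    fix i j e assume "i \<in> {1..\<mu>}" "j \<in> {1..\<mu>}" "h i e = h j e"
    \<comment> \<open>Here the fixed color \<open>c e\<close> is cancelled; the indices differ by
      less than \<open>l\<close> because \<open>\<mu> \<le> l\<close>.\<close>
    then show "i = j"
      using \<open>\<mu> \<le> l\<close> by - (rule mod_add_right_inj[of _ "c e" l], auto simp: h_def add.commute)
  qed (use h_range h_inj in blast)+
  then show ?thesis
    by (auto simp: admits_simultaneous_edge_coloring_def)
qed

section \<open>Complete bipartite graphs\<close>

definition complete_bipartite_edges :: "'a set \<Rightarrow> 'a set \<Rightarrow> 'a set set" where
  "complete_bipartite_edges A B = {{a, b} |a b. a \<in> A \<and> b \<in> B}"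

lemma complete_bipartite_edges_commute:
  "complete_bipartite_edges A B = complete_bipartite_edges B A"
  unfolding complete_bipartite_edges_def by (auto simp: insert_commute)

text \<open>Let \<open>A\<close> index the rows and \<open>B\<close> the columns of the rectangle
  with entries r + s modulo the larger size. Rotating the rows permutes the entries of each column,
  and every row contains all colors, so no vertex sees a change of its color set.\<close>

lemma admits_simultaneous_edge_coloring_complete_bipartite:
  assumes "finite A" "finite B" "A \<inter> B = {}" "\<mu> \<le> card A" "\<mu> \<le> card B"
  shows "admits_simultaneous_edge_coloring \<mu> V (complete_bipartite_edges A B)"
  using assms
\<comment> \<open>By symmetry \<open>A\<close> is the smaller side, so that distinct row numbers
  stay distinct modulo \<open>card B\<close>.\<close>
proof (induction "card A" "card B" arbitrary: A B rule: linorder_wlog)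
  case sym
  then show ?case
    by (metis complete_bipartite_edges_commute inf_commute)
next
  case le
  define m k E where "m = card A" and "k = card B" and "E = complete_bipartite_edges A B"
  obtain f where f: "bij_betw f A {..<m}"
    using ex_bij_betw_finite_nat[OF \<open>finite A\<close>] by (auto simp: m_def atLeast0LessThan)
  obtain g where g: "bij_betw g B {..<k}"
    using ex_bij_betw_finite_nat[OF \<open>finite B\<close>] by (auto simp: k_def atLeast0LessThan)
  define F where "F i a = (f a + i) mod m" for i a
  \<comment> \<open>An edge meets each side in one vertex, which \<open>the_elem\<close>
    extracts.\<close>
  define c where "c i e = Suc ((F i (the_elem (e \<inter> A)) + g (the_elem (e \<inter> B))) mod k)" for i e
  have F: "bij_betw (F i) A {..<m}" for i
    unfolding F_def by (rule bij_betw_mod_add[OF f])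
  have mk: "m \<le> k" "\<mu> \<le> m"
    using le by (auto simp: m_def k_def)
  have F_less: "F i a < m" "F i a < k" if "a \<in> A" for i a
    using F[of i] that mk by (auto simp: bij_betw_def dest!: equalityD1)
  have g_less: "g b < k" if "b \<in> B" for b
    using g that by (auto simp: bij_betw_def)
  have c_eq: "c i {a, b} = Suc ((F i a + g b) mod k)" if "a \<in> A" "b \<in> B" for i a b
  proof -
    have "{a, b} \<inter> A = {a}" "{a, b} \<inter> B = {b}"
      using that \<open>A \<inter> B = {}\<close> by auto
    then show ?thesis
      by (simp add: c_def)
  qed
  have row: "b = b'" if "a \<in> A" "b \<in> B" "b' \<in> B" "c i {a, b} = c i {a, b'}" for i a b b'
  proof -
    have "g b = g b'"
    proof (rule mod_add_right_inj)
      show "(g b + F i a) mod k = (g b' + F i a) mod k"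
        using that by (simp add: c_eq add.commute)
    qed (use that g_less in \<open>auto intro: trans_less_add2\<close>)
    then show ?thesis
      using g that by (auto simp: bij_betw_def inj_on_def)
  qed
  have col: "a = a'" if "a \<in> A" "a' \<in> A" "b \<in> B" "c i {a, b} = c i {a', b}" for i a a' b
  proof -
    have "F i a = F i a'"
    proof (rule mod_add_right_inj)
      show "(F i a + g b) mod k = (F i a' + g b) mod k"
        using that by (simp add: c_eq)
    qed (use that F_less in \<open>auto intro: trans_less_add2\<close>)
    then show ?thesis
      using F[of i] that by (auto simp: bij_betw_def inj_on_def)
  qed
  \<comment> \<open>A vertex of \<open>A\<close> sees a full row; a vertex \<open>v\<close> of
    \<open>B\<close> sees \<open>m\<close> cyclically consecutive colors starting from residue
    \<open>g v\<close>.\<close>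
  define S where "S v = (if v \<in> A then Suc ` {..<k}
    else if v \<in> B then (\<lambda>r. Suc ((r + g v) mod k)) ` {..<m} else {})" for v
  have "simultaneous_edge_coloring \<mu> V E k c"
  proof (rule simultaneous_edge_coloringI)
    fix i e assume "e \<in> E"
    then obtain a b where "e = {a, b}" "a \<in> A" "b \<in> B"
      by (auto simp: E_def complete_bipartite_edges_def)
    then show "c i e \<in> {1..k}"
      using g_less[of b] by (simp add: c_eq Suc_le_eq)
  next
    fix i e f assume "e \<in> E" "f \<in> E" and *: "e \<inter> f \<noteq> {}" "c i e = c i f"
    then obtain a b a' b' where e: "e = {a, b}" "a \<in> A" "b \<in> B" and f: "f = {a', b'}" "a' \<in> A" "b' \<in> B"
      unfolding E_def complete_bipartite_edges_def by blast
    then have "a = a' \<or> b = b'"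
      using * \<open>A \<inter> B = {}\<close> by auto
    then show "e = f"
      using e f * row[of a b b' i] col[of a a' b i] by auto
  next
    fix i v
    consider "v \<in> A" "v \<notin> B" | "v \<in> B" "v \<notin> A" | "v \<notin> A" "v \<notin> B"
      using \<open>A \<inter> B = {}\<close> by auto
    then show "c i ` incident_edges E v = S v"
    proof cases
      case 1
      then have "incident_edges E v = (\<lambda>b. {v, b}) ` B"
        by (auto simp: E_def incident_edges_def complete_bipartite_edges_def)
      then have "c i ` incident_edges E v = Suc ` (\<lambda>b. (g b + F i v) mod k) ` B"
        using 1 by (auto simp: image_image c_eq add.commute intro!: image_cong)
      then show ?thesis
        using 1 bij_betw_mod_add[OF g, of "F i v"] by (simp add: S_def bij_betw_def)
    next
      case 2
      then have "incident_edges E v = (\<lambda>a. {a, v}) ` A"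
        by (auto simp: E_def incident_edges_def complete_bipartite_edges_def)
      then have "c i ` incident_edges E v = (\<lambda>r. Suc ((r + g v) mod k)) ` F i ` A"
        using 2 by (auto simp: image_image c_eq intro!: image_cong)
      then show ?thesis
        using 2 F[of i] by (simp add: S_def bij_betw_def)
    next
      case 3
      then show ?thesis
        by (auto simp: S_def E_def incident_edges_def complete_bipartite_edges_def)
    qed
  next
    fix i j e assume ij: "i \<in> {1..\<mu>}" "j \<in> {1..\<mu>}" and "e \<in> E" and eq: "c i e = c j e"
    then obtain a b where e: "e = {a, b}" "a \<in> A" "b \<in> B"
      by (auto simp: E_def complete_bipartite_edges_def)
    \<comment> \<open>Cancelling the column modulo \<open>k\<close> gives equal rows; cancelling
      \<open>f a\<close> modulo \<open>m\<close> then gives equal shifts, as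
      \<open>\<mu> \<le> m\<close>.\<close>
    then have "F i a = F j a"
      using eq F_less[of a i] F_less[of a j]
      by - (rule mod_add_right_inj[of _ "g b" k], auto simp: c_eq)
    then show "i = j"
      using ij mk by - (rule mod_add_right_inj[of _ "f a" m], auto simp: F_def add.commute)
  qed
  then show ?case
    by (auto simp: admits_simultaneous_edge_coloring_def E_def)
qed

section \<open>One-factorization and complete graphs of even order\<close>

text \<open>
  The standard one-factorization: label the vertices \<open>0, \<dots>, p\<close> with \<open>p\<close> odd, and give the edge
  \<open>xy\<close> the color \<open>x + y\<close> modulo \<open>p\<close>, except that \<open>xp\<close> gets the color \<open>2x\<close>.
\<close>

lemma proper_edge_coloring_complete_even:
  assumes "finite A" "card A = Suc p" "odd p"
  shows "\<exists>c. proper_edge_coloring (nsets A 2) p c"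
proof -
  obtain f where f: "bij_betw f A {..p}"
    using ex_bij_betw_finite_nat[OF \<open>finite A\<close>] assms
    by (auto simp: atLeast0LessThan lessThan_Suc_atMost)
  then have inj: "inj_on f A" and le: "\<And>x. x \<in> A \<Longrightarrow> f x \<le> p"
    by (auto simp: bij_betw_def)
  \<comment> \<open>The label \<open>p\<close> is the point at infinity; \<open>q\<close> is the
    color before reduction modulo \<open>p\<close> and \<open>Suc\<close>.\<close>
  define q where "q x y = (if x = p then y + y else if y = p then x + x else x + y)" for x y
  \<comment> \<open>Using \<open>sum f e\<close> makes the color independent of the order of the
    endpoints. On an edge with label \<open>p\<close>, the doubled sum 2p + 2x is congruent to
    2x.\<close>
  define c where "c e = Suc ((if p \<in> f ` e then sum f e + sum f e else sum f e) mod p)" for e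
  have c_eq: "c {x, y} = Suc (q (f x) (f y) mod p)" if "x \<in> A" "y \<in> A" "x \<noteq> y" for x y
  proof -
    have "f x \<noteq> f y"
      using that inj by (auto simp: inj_on_def)
    moreover have "(p + u + (p + u)) mod p = (u + u) mod p" for u
      by (metis add.assoc add.left_commute mod_add_self1)
    moreover have "(u + p + (u + p)) mod p = (u + u) mod p" for u
      by (metis add.assoc add.left_commute add.commute mod_add_self1)
    ultimately show ?thesis
      using that by (auto simp: c_def q_def)
  qed
  \<comment> \<open>Doubling is injective on residues because \<open>p\<close> is odd.\<close>
  have double: "x = y" if "(x + x) mod p = (y + y) mod p" "x < p" "y < p" for x y
  proof -
    have "[2 * x = 2 * y] (mod p)" "coprime 2 p"
      using that \<open>odd p\<close> by (simp_all add: cong_def mult_2)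
    then show ?thesis
      using that cong_mult_lcancel_nat cong_less_modulus_unique_nat by blast
  qed
  have add: "x = y" if "(a + x) mod p = (a + y) mod p" "x < p" "y < p" for a x y
    using that by - (rule mod_add_right_inj[of x a p y], simp_all add: add.commute)
  \<comment> \<open>For \<open>a < p\<close>, the sums a + x with x < p and x \<noteq> a miss
    exactly the residue of 2a, which is left for the edge to \<open>p\<close>. For
    \<open>a = p\<close> all colors are doubles.\<close>
  have q_inj: "x = y" if "q a x mod p = q a y mod p" "a \<le> p" "x \<le> p" "y \<le> p" "a \<noteq> x" "a \<noteq> y" for a x y
    using that double[of x y] add[of a x y] add[of a a y] add[of a x a]
    by (auto simp: q_def split: if_splits)
  have "proper_edge_coloring (nsets A 2) p c"
    unfolding proper_edge_coloring_def
  proof (intro conjI ballI impI funcsetI)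
    fix e assume "e \<in> nsets A 2"
    show "c e \<in> {1..p}"
      using odd_pos[OF \<open>odd p\<close>] by (simp add: c_def Suc_le_eq)
  next
    fix e e' assume e: "e \<in> nsets A 2" "e' \<in> nsets A 2" and "e \<noteq> e' \<and> e \<inter> e' \<noteq> {}"
    then obtain a where a: "a \<in> e" "a \<in> e'" and "e \<noteq> e'"
      by auto
    have "\<exists>x\<in>A. d = {a, x} \<and> a \<noteq> x" if "d \<in> nsets A 2" "a \<in> d" for d
      using that by (auto simp: nsets_2_eq)
    then obtain x y where xy: "x \<in> A" "y \<in> A" "e = {a, x}" "e' = {a, y}" "a \<noteq> x" "a \<noteq> y"
      using e a by metis
    have "a \<in> A"
      using e a by (auto simp: nsets_def)
    show "c e \<noteq> c e'"
    proof
      assume "c e = c e'"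
      then have "q (f a) (f x) mod p = q (f a) (f y) mod p"
        using xy \<open>a \<in> A\<close> by (simp add: c_eq)
      moreover have "f a \<noteq> f x" "f a \<noteq> f y"
        using xy \<open>a \<in> A\<close> inj by (auto simp: inj_on_def)
      ultimately have "f x = f y"
        using xy \<open>a \<in> A\<close> le by - (rule q_inj, auto)
      then show False
        using xy inj \<open>e \<noteq> e'\<close> by (auto simp: inj_on_def)
    qed
  qed
  then show ?thesis
    by blast
qed

lemma incident_edges_nsets_2:
  "incident_edges (nsets A 2) v = (if v \<in> A then (\<lambda>x. {v, x}) ` (A - {v}) else {})"
  by (auto simp: incident_edges_def nsets_2_eq)

text \<open>The one-factorization uses \<open>card A - 1\<close> colors, which is the degree of each
  vertex of \<open>A\<close>; vertices of \<open>V\<close> outside \<open>A\<close> are isolated.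
  Hence the criterion for regular graphs applies.\<close>

lemma admits_simultaneous_edge_coloring_complete_even:
  assumes "finite A" "even (card A)" "\<mu> < card A"
  shows "admits_simultaneous_edge_coloring \<mu> V (nsets A 2)"
proof -
  obtain p where p: "card A = Suc p" "odd p" "\<mu> \<le> p"
    using assms by (cases "card A") auto
  obtain c where "proper_edge_coloring (nsets A 2) p c"
    using proper_edge_coloring_complete_even[OF \<open>finite A\<close> p(1,2)] by blast
  then show ?thesis
  proof (rule admits_simultaneous_edge_coloring_regular)
    fix v
    have "inj_on (\<lambda>x. {v, x}) (A - {v})"
      by (auto simp: inj_on_def doubleton_eq_iff)
    then show "incident_edges (nsets A 2) v = {} \<or> card (incident_edges (nsets A 2) v) = p"
      using p \<open>finite A\<close> by (auto simp: incident_edges_nsets_2 card_image)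
  qed (fact p)
qed

section \<open>Decomposition of complete graphs of odd order, and the conclusion\<close>

text \<open>The two complete graphs meet only in \<open>x\<close>, so they share no edge; the pairs
  they leave out are those between \<open>B\<close> and \<open>C\<close>.\<close>

lemma admits_simultaneous_edge_coloring_nsets_insert_Un:
  assumes "admits_simultaneous_edge_coloring \<mu> V (nsets (insert x B) 2)"
    and "admits_simultaneous_edge_coloring \<mu> V (nsets (insert x C) 2)"
    and "admits_simultaneous_edge_coloring \<mu> V (complete_bipartite_edges B C)"
    and "x \<notin> B" "x \<notin> C" "B \<inter> C = {}"
  shows "admits_simultaneous_edge_coloring \<mu> V (nsets (insert x (B \<union> C)) 2)"
proof -
  let ?B = "nsets (insert x B) 2" and ?C = "nsets (insert x C) 2"
  let ?BC = "complete_bipartite_edges B C"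
  have "?B \<inter> ?C = {}"
    using assms(4-6) by (auto simp: nsets_2_eq doubleton_eq_iff)
  moreover have "(?B \<union> ?C) \<inter> ?BC = {}"
    using assms(4-6) by (auto simp: nsets_2_eq doubleton_eq_iff complete_bipartite_edges_def)
  ultimately have "admits_simultaneous_edge_coloring \<mu> V (?B \<union> ?C \<union> ?BC)"
    using assms(1-3) by (intro admits_simultaneous_edge_coloring_Un)
  moreover have "nsets (insert x (B \<union> C)) 2 = ?B \<union> ?C \<union> ?BC"
  proof
    show "nsets (insert x (B \<union> C)) 2 \<subseteq> ?B \<union> ?C \<union> ?BC"
    proof
      fix e assume "e \<in> nsets (insert x (B \<union> C)) 2"
      then obtain y z where e: "e = {y, z}" "y \<in> insert x (B \<union> C)" "z \<in> insert x (B \<union> C)" "y \<noteq> z"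
        by (auto simp: nsets_2_eq)
      moreover have "e \<in> ?BC" if "y \<in> B \<and> z \<in> C \<or> z \<in> B \<and> y \<in> C"
        using that e(1) unfolding complete_bipartite_edges_def by blast
      ultimately show "e \<in> ?B \<union> ?C \<union> ?BC"
        by (auto simp: doubleton_in_nsets_2)
    qed
    show "?B \<union> ?C \<union> ?BC \<subseteq> nsets (insert x (B \<union> C)) 2"
      using assms(4-6) by (auto simp: complete_bipartite_edges_def nsets_def card_insert_if)
  qed
  ultimately show ?thesis
    by simp
qed

lemma admits_simultaneous_edge_coloring_complete:
  assumes "finite A" "card A \<notin> {0, 2, 3, 5}"
  shows "admits_simultaneous_edge_coloring 3 V (nsets A 2)"
proof -
  have "card A = 1 \<or> even (card A) \<and> card A \<ge> 4 \<or> odd (card A) \<and> card A \<ge> 7"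
    using assms(2) by (simp, presburger)
  then consider "card A = 1" | "even (card A)" "card A \<ge> 4" | "odd (card A)" "card A \<ge> 7"
    by blast
  then show ?thesis
  proof cases
    case 1
    then have "nsets A 2 = {}"
      by (auto simp: nsets_2_eq card_1_singleton_iff)
    then show ?thesis
      by (auto simp: admits_simultaneous_edge_coloring_def simultaneous_edge_coloring_def
          proper_edge_coloring_def incident_edges_def)
  next
    case 2
    then show ?thesis
      using \<open>finite A\<close> by (intro admits_simultaneous_edge_coloring_complete_even) auto
  next
    case 3
    then obtain x where x: "x \<in> A"
      by fastforce
    \<comment> \<open>Three vertices besides \<open>x\<close> form a complete graph of order 4 with
      it. Then \<open>insert x C\<close> has the even size \<open>card A - 3\<close>, at least 4,
      and \<open>C\<close> has at least 3 elements, so each piece admits \<mu> = 3.\<close>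
    have "3 \<le> card (A - {x})"
      using 3 x \<open>finite A\<close> by simp
    then obtain B where B: "B \<subseteq> A - {x}" "card B = 3" "finite B"
      by (rule obtain_subset_with_card_n)
    define C where "C = A - {x} - B"
    have C: "card C = card A - 4" "finite C"
      using B x \<open>finite A\<close> by (simp_all add: C_def card_Diff_subset)
    have "A = insert x (B \<union> C)" and disj: "x \<notin> B" "x \<notin> C" "B \<inter> C = {}"
      using B x by (auto simp: C_def)
    have "admits_simultaneous_edge_coloring 3 V (nsets (insert x B) 2)"
      using B disj by (intro admits_simultaneous_edge_coloring_complete_even) auto
    moreover have "admits_simultaneous_edge_coloring 3 V (nsets (insert x C) 2)"
      using C disj 3 by (intro admits_simultaneous_edge_coloring_complete_even) auto
    moreover have "admits_simultaneous_edge_coloring 3 V (complete_bipartite_edges B C)"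
      using B C disj 3 by (intro admits_simultaneous_edge_coloring_complete_bipartite) auto
    ultimately have "admits_simultaneous_edge_coloring 3 V (nsets (insert x (B \<union> C)) 2)"
      using disj by (rule admits_simultaneous_edge_coloring_nsets_insert_Un)
    then show ?thesis
      using \<open>A = insert x (B \<union> C)\<close> by simp
  qed
qed

theorem theorem2p11:
  fixes n :: nat
  assumes "n > 0" and "n \<notin> {2, 3, 5}"
  shows "admits_simultaneous_edge_coloring 2 (K_verts n) (K_edges n) \<and>
         admits_simultaneous_edge_coloring 3 (K_verts n) (K_edges n)"
proof -
  have "admits_simultaneous_edge_coloring 3 (K_verts n) (K_edges n)"
    using admits_simultaneous_edge_coloring_complete[of "K_verts n"] assms
    by (simp add: K_edges_def K_verts_def)
  \<comment> \<open>Dropping the third coloring settles \<mu> = 2.\<close>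
  then show ?thesis
    using admits_simultaneous_edge_coloring_mono[of 3 _ _ 2] by auto
qed

end
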